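(* Let $\Gamma=(N,(C_i)_{i\in N},(U_i)_{i\in N})$ be a finite game and let $\Gamma'=(N,(C_i)_{i\in N},(U'_i)_{i\in N})$ be a rescaling of $\Gamma$. If $\alpha$ is a dual vector of $\Gamma$, then there exists a dual vector $\alpha'$ of $\Gamma'$ such that $\Gamma'/\alpha'=\Gamma'/\alpha$. That is, $\Gamma'/\alpha$ is a dual reduction of $\Gamma'$.
   Context: A finite game in strategic form is $\Gamma=(N,(C_i)_{i\in N},(U_i)_{i\in N})$, where $N$ is a finite nonempty set of players, $C_i$ is the finite nonempty set of pure strategies of player $i$, $C=\prod_{j\in N}C_j$, $C_{-i}=\prod_{j\ne i}C_j$, and $U_i:C\to\mathbb{R}$ is the utility function of player $i$, extended multilinearly to mixed strategies. The game $\Gamma'$ (same players and pure strategies) is a rescaling of $\Gamma$ if for every $i\in N$ there exist a constant $a_i>0$ and a function $f_i:C_{-i}\to\mathbb{R}$ such that $U'_i(c)=a_iU_i(c)+f_i(c_{-i})$ for all $c\in C$. A deviation plan for player $i$ is a map $\alpha_i:C_i\to\Delta(C_i)$; write $\alpha_i\ast c_i$ for the image of $c_i$, and $\alpha_i\ast\sigma_i=\sum_{c_i}\sigma_i(c_i)(\alpha_i\ast c_i)$ for $\sigma_i\in\Delta(C_i)$. A dual vector of a game with utilities $(U_i)$ is a profile of deviation plans $\alpha=(\alpha_i)_{i\in N}$ such that $\sum_{i\in N}[U_i(c_{-i},\alpha_i\ast c_i)-U_i(c)]\ge 0$ for every $c\in C$. A nonempty $B_i\subset C_i$ is $\alpha_i$-absorbing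 if $\alpha_i\ast c_i$ has support in $B_i$ for every $c_i\in B_i$, and minimal $\alpha_i$-absorbing if moreover it has no nonempty proper absorbing subset. For each minimal $\alpha_i$-absorbing set there is a unique $\alpha_i$-stationary mixed strategy ($\alpha_i\ast\sigma_i=\sigma_i$) supported in it; $C_i/\alpha_i\subset\Delta(C_i)$ denotes the set of these strategies. For any profile of deviation plans $\alpha$ and any game $G$ with player set $N$ and strategy sets $(C_i)$, $G/\alpha$ is the game with player set $N$, pure strategy sets $C_i/\alpha_i$ and the (multilinearly extended) utility functions of $G$. A dual reduction of $G$ is a game $G/\alpha$ with $\alpha$ a dual vector of $G$. *)

theory Defs
  imports "HOL-Probability.Probability_Mass_Function"
begin

(* All players draw their pure strategies from one type 's (a disjoint sum, if necessary);
   strats G i matters only for i in players G, and util G i only on profiles G. *)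
record ('i, 's) game =
  players :: "'i set"
  strats  :: "'i \<Rightarrow> 's set"
  util    :: "'i \<Rightarrow> ('i \<Rightarrow> 's) \<Rightarrow> real"

definition finite_game :: "('i, 's) game \<Rightarrow> bool" where
  "finite_game G \<longleftrightarrow> finite (players G) \<and> players G \<noteq> {} \<and>
     (\<forall>i\<in>players G. finite (strats G i) \<and> strats G i \<noteq> {})"

definition profiles :: "('i, 's) game \<Rightarrow> ('i \<Rightarrow> 's) set" where
  "profiles G = (\<Pi>\<^sub>E i\<in>players G. strats G i)"

(* The restriction of c to players G - {i} is the opponents' profile, usually written c_{-i}. *)
definition is_rescaling :: "('i, 's) game \<Rightarrow> ('i, 's) game \<Rightarrow> bool" where
  "is_rescaling G G' \<longleftrightarrow>
     players G' = players G \<and>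
     (\<forall>i\<in>players G. strats G' i = strats G i) \<and>
     (\<forall>i\<in>players G. \<exists>a>0. \<exists>f :: ('i \<Rightarrow> 's) \<Rightarrow> real. \<forall>c\<in>profiles G.
        util G' i c = a * util G i c + f (restrict c (players G - {i})))"

definition mixed_util :: "('i, 's) game \<Rightarrow> 'i \<Rightarrow> ('i \<Rightarrow> 's pmf) \<Rightarrow> real" where
  "mixed_util G i \<sigma> =
     (\<Sum>c\<in>profiles G. (\<Prod>j\<in>players G. pmf (\<sigma> j) (c j)) * util G i c)"

(* A plan maps pure to mixed strategies; its action on a mixed strategy is bind_pmf. *)
definition deviation_plan :: "'s set \<Rightarrow> ('s \<Rightarrow> 's pmf) \<Rightarrow> bool" where
  "deviation_plan S \<alpha> \<longleftrightarrow> (\<forall>s\<in>S. set_pmf (\<alpha> s) \<subseteq> S)"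

definition deviation_profile :: "('i, 's) game \<Rightarrow> ('i \<Rightarrow> 's \<Rightarrow> 's pmf) \<Rightarrow> bool" where
  "deviation_profile G \<alpha> \<longleftrightarrow> (\<forall>i\<in>players G. deviation_plan (strats G i) (\<alpha> i))"

definition dual_vector :: "('i, 's) game \<Rightarrow> ('i \<Rightarrow> 's \<Rightarrow> 's pmf) \<Rightarrow> bool" where
  "dual_vector G \<alpha> \<longleftrightarrow> deviation_profile G \<alpha> \<and>
     (\<forall>c\<in>profiles G.
        (\<Sum>i\<in>players G.
           mixed_util G i ((\<lambda>j. return_pmf (c j))(i := \<alpha> i (c i))) - util G i c) \<ge> 0)"

definition absorbing :: "'s set \<Rightarrow> ('s \<Rightarrow> 's pmf) \<Rightarrow> 's set \<Rightarrow> bool" where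
  "absorbing S \<alpha> B \<longleftrightarrow> B \<noteq> {} \<and> B \<subseteq> S \<and> (\<forall>s\<in>B. set_pmf (\<alpha> s) \<subseteq> B)"

definition minimal_absorbing :: "'s set \<Rightarrow> ('s \<Rightarrow> 's pmf) \<Rightarrow> 's set \<Rightarrow> bool" where
  "minimal_absorbing S \<alpha> B \<longleftrightarrow> absorbing S \<alpha> B \<and> \<not> (\<exists>B'. B' \<subset> B \<and> absorbing S \<alpha> B')"

definition stationary :: "('s \<Rightarrow> 's pmf) \<Rightarrow> 's pmf \<Rightarrow> bool" where
  "stationary \<alpha> \<sigma> \<longleftrightarrow> bind_pmf \<sigma> \<alpha> = \<sigma>"

definition quotient_strats :: "'s set \<Rightarrow> ('s \<Rightarrow> 's pmf) \<Rightarrow> 's pmf set" where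
  "quotient_strats S \<alpha> =
     {\<sigma>. stationary \<alpha> \<sigma> \<and> (\<exists>B. minimal_absorbing S \<alpha> B \<and> set_pmf \<sigma> \<subseteq> B)}"

(* Both functions are cut down to their mathematical domains, so that HOL equality of two
   reduced games is equality of player sets, strategy sets and utility functions. *)
definition reduced_game ::
  "('i, 's) game \<Rightarrow> ('i \<Rightarrow> 's \<Rightarrow> 's pmf) \<Rightarrow> ('i, 's pmf) game" where
  "reduced_game G \<alpha> =
     \<lparr> players = players G,
       strats = (\<lambda>i\<in>players G. quotient_strats (strats G i) (\<alpha> i)),
       util = (\<lambda>i\<in>players G.
                 \<lambda>\<sigma>\<in>(\<Pi>\<^sub>E j\<in>players G. quotient_strats (strats G j) (\<alpha> j)). mixed_util G i \<sigma>) \<rparr>"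

definition dual_reduction :: "('i, 's) game \<Rightarrow> ('i, 's pmf) game \<Rightarrow> bool" where
  "dual_reduction G H \<longleftrightarrow> (\<exists>\<alpha>. dual_vector G \<alpha> \<and> H = reduced_game G \<alpha>)"

end

theory Submission
  imports Defs
begin

text \<open>
  Rescaling player \<open>i\<close>'s utility by \<open>a\<^sub>i\<close> multiplies that player's gain from every unilateral
  deviation by \<open>a\<^sub>i\<close>, since the summand that depends only on the opponents cancels
  (\<open>rescaled_deviation_gain\<close>).  When the factors differ between players, this may destroy
  the nonnegativity of the total gain.  To undo it, player \<open>i\<close> follows the plan \<open>\<alpha>\<^sub>i\<close> only with
  probability \<open>\<epsilon>\<^sub>i\<close> and otherwise keeps the recommended strategy; this multiplies the gain by
  \<open>\<epsilon>\<^sub>i\<close> (\<open>lazy_deviation_gain\<close>).  Let \<open>m\<close> be the least of the factors.  The choice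
  \<open>\<epsilon>\<^sub>i = m / a\<^sub>i\<close>, which lies in \<open>(0,1]\<close>, makes every player's gain exactly \<open>m\<close> times the
  original one, so the total gain stays nonnegative.

  The reduced game does not change: a Markov chain and its lazy version with a positive
  probability of moving have the same absorbing sets and the same stationary distributions
  (\<open>quotient_strats_lazy_plan\<close>).
\<close>

section \<open>Lazy deviation plans\<close>

definition lazy_plan :: "real \<Rightarrow> ('s \<Rightarrow> 's pmf) \<Rightarrow> 's \<Rightarrow> 's pmf" where
  "lazy_plan e \<alpha> s = bind_pmf (bernoulli_pmf e) (\<lambda>b. if b then \<alpha> s else return_pmf s)"

lemma pmf_bernoulli_mixture:
  assumes "0 \<le> e" "e \<le> 1"
  shows "pmf (bind_pmf (bernoulli_pmf e) (\<lambda>b. if b then \<mu> else \<nu>)) x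
           = e * pmf \<mu> x + (1 - e) * pmf \<nu> x"
  using assms by (simp add: pmf_bind)

lemma set_pmf_lazy_plan:
  assumes "0 < e" "e \<le> 1"
  shows "set_pmf (lazy_plan e \<alpha> s) = set_pmf (\<alpha> s) \<union> (if e = 1 then {} else {s})"
proof -
  have "x \<in> set_pmf (lazy_plan e \<alpha> s) \<longleftrightarrow> x \<in> set_pmf (\<alpha> s) \<or> (e \<noteq> 1 \<and> x = s)" for x
  proof -
    have "0 \<le> e * pmf (\<alpha> s) x" "0 \<le> (1 - e) * indicat_real {s} x"
      using assms by auto
    then show ?thesis
      using assms unfolding set_pmf_iff lazy_plan_def
      by (auto simp: pmf_bernoulli_mixture add_nonneg_eq_0_iff indicator_def split: if_splits)
  qed
  then show ?thesis by auto
qed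

lemma deviation_plan_lazy_plan:
  assumes "0 < e" "e \<le> 1" "deviation_plan S \<alpha>"
  shows "deviation_plan S (lazy_plan e \<alpha>)"
  using assms by (auto simp: deviation_plan_def set_pmf_lazy_plan split: if_splits)

text \<open>Staying put never leaves a set, so only the moves made by \<open>\<alpha>\<close> matter.\<close>

lemma absorbing_lazy_plan:
  assumes "0 < e" "e \<le> 1"
  shows "absorbing S (lazy_plan e \<alpha>) B \<longleftrightarrow> absorbing S \<alpha> B"
  using assms by (auto simp: absorbing_def set_pmf_lazy_plan)

text \<open>
  The lazy plan sends \<open>\<sigma>\<close> to \<open>e (\<alpha> \<ast> \<sigma>) + (1 - e) \<sigma>\<close>, and for \<open>e > 0\<close> this
  mixture equals \<open>\<sigma>\<close> only if \<open>\<alpha> \<ast> \<sigma>\<close> does.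
\<close>

lemma stationary_lazy_plan:
  assumes "0 < e" "e \<le> 1"
  shows "stationary (lazy_plan e \<alpha>) \<sigma> \<longleftrightarrow> stationary \<alpha> \<sigma>"
proof -
  have "bind_pmf \<sigma> (lazy_plan e \<alpha>)
      = bind_pmf (bernoulli_pmf e) (\<lambda>b. bind_pmf \<sigma> (\<lambda>s. if b then \<alpha> s else return_pmf s))"
    unfolding lazy_plan_def by (rule bind_commute_pmf)
  also have "\<dots> = bind_pmf (bernoulli_pmf e) (\<lambda>b. if b then bind_pmf \<sigma> \<alpha> else \<sigma>)"
    by (intro bind_pmf_cong) (auto simp: bind_return_pmf')
  finally have "pmf (bind_pmf \<sigma> (lazy_plan e \<alpha>)) x
      = e * pmf (bind_pmf \<sigma> \<alpha>) x + (1 - e) * pmf \<sigma> x" for x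
    using assms by (simp add: pmf_bernoulli_mixture)
  then have "pmf (bind_pmf \<sigma> (lazy_plan e \<alpha>)) x - pmf \<sigma> x
      = e * (pmf (bind_pmf \<sigma> \<alpha>) x - pmf \<sigma> x)" for x
    by (simp add: algebra_simps)
  then have "pmf (bind_pmf \<sigma> (lazy_plan e \<alpha>)) x = pmf \<sigma> x
      \<longleftrightarrow> pmf (bind_pmf \<sigma> \<alpha>) x = pmf \<sigma> x" for x
    using assms(1) by (metis eq_iff_diff_eq_0 less_irrefl mult_eq_0_iff)
  then show ?thesis by (simp add: stationary_def pmf_eq_iff)
qed

lemma quotient_strats_lazy_plan:
  assumes "0 < e" "e \<le> 1"
  shows "quotient_strats S (lazy_plan e \<alpha>) = quotient_strats S \<alpha>"
  using assms
  by (simp add: quotient_strats_def minimal_absorbing_def absorbing_lazy_plan stationary_lazy_plan)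

lemma reduced_game_cong:
  assumes "\<And>i. i \<in> players G \<Longrightarrow>
    quotient_strats (strats G i) (\<alpha> i) = quotient_strats (strats G i) (\<beta> i)"
  shows "reduced_game G \<alpha> = reduced_game G \<beta>"
proof -
  have "(\<Pi>\<^sub>E j\<in>players G. quotient_strats (strats G j) (\<alpha> j))
      = (\<Pi>\<^sub>E j\<in>players G. quotient_strats (strats G j) (\<beta> j))"
    using assms by (intro PiE_cong)
  then show ?thesis
    using assms by (simp add: reduced_game_def cong: restrict_cong)
qed

section \<open>Gains from unilateral deviations\<close>

lemma profile_update:
  assumes "c \<in> profiles G" "i \<in> players G" "s \<in> strats G i"
  shows "c(i := s) \<in> profiles G"
  using assms by (auto simp: profiles_def PiE_iff extensional_def)

text \<open>
  The sum over all profiles collapses to player \<open>i\<close>'s strategies: a profile that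
  differs from \<open>c\<close> at an opponent has probability zero.
\<close>

lemma mixed_util_unilateral:
  assumes "finite_game G" "i \<in> players G" "c \<in> profiles G"
  shows "mixed_util G i ((\<lambda>j. return_pmf (c j))(i := \<mu>))
           = (\<Sum>s\<in>strats G i. pmf \<mu> s * util G i (c(i := s)))"
proof -
  let ?\<sigma> = "(\<lambda>j. return_pmf (c j))(i := \<mu>)"
  let ?w = "\<lambda>d. \<Prod>j\<in>players G. pmf (?\<sigma> j) (d j)"
  let ?D = "(\<lambda>s. c(i := s)) ` strats G i"
  have fin: "finite (players G)" "finite (profiles G)"
    using assms(1) by (auto simp: finite_game_def profiles_def intro!: finite_PiE)
  have weight: "?w d = pmf \<mu> (d i) * (\<Prod>j\<in>players G - {i}. pmf (return_pmf (c j)) (d j))" for d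
    using fin(1) assms(2) by (simp add: prod.remove del: pmf_return)
  have subset: "?D \<subseteq> profiles G"
    using profile_update[OF assms(3,2)] by blast
  have null: "?w d = 0" if d: "d \<in> profiles G - ?D" for d
  proof -
    have "d \<in> profiles G" "d i \<in> strats G i"
      using d assms(2) by (auto simp: profiles_def)
    then have "c(i := d i) \<in> ?D" by (intro imageI)
    then have "c(i := d i) \<noteq> d" using d by (metis DiffD2)
    then obtain j where "(c(i := d i)) j \<noteq> d j" by blast
    then have "j \<noteq> i" "c j \<noteq> d j" by (auto split: if_splits)
    moreover have "j \<in> players G"
    proof (rule ccontr)
      assume "j \<notin> players G"
      then have "c j = undefined" "d j = undefined"
        using assms(3) \<open>d \<in> profiles G\<close> unfolding profiles_def by (blast intro: PiE_arb)+
      then show False using \<open>c j \<noteq> d j\<close> by simp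
    qed
    ultimately have "\<exists>j\<in>players G - {i}. pmf (return_pmf (c j)) (d j) = 0"
      by (intro bexI[of _ j]) (auto simp: indicator_def)
    then show ?thesis
      using fin(1) unfolding weight by (simp add: prod_zero_iff del: pmf_return)
  qed
  have "mixed_util G i ?\<sigma> = (\<Sum>d\<in>?D. ?w d * util G i d)"
    unfolding mixed_util_def
    by (rule sum.mono_neutral_right) (use fin subset null in auto)
  also have "\<dots> = (\<Sum>s\<in>strats G i. ?w (c(i := s)) * util G i (c(i := s)))"
    by (subst sum.reindex) (auto simp: inj_on_def dest: fun_upd_eqD)
  also have "\<dots> = (\<Sum>s\<in>strats G i. pmf \<mu> s * util G i (c(i := s)))"
    unfolding weight by simp
  finally show ?thesis .
qed

lemma mixed_util_pure:
  assumes "finite_game G" "i \<in> players G" "c \<in> profiles G"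
  shows "mixed_util G i ((\<lambda>j. return_pmf (c j))(i := return_pmf (c i))) = util G i c"
proof -
  have "finite (strats G i)" "c i \<in> strats G i"
    using assms by (auto simp: finite_game_def profiles_def)
  then show ?thesis
    by (simp add: mixed_util_unilateral[OF assms] indicator_def if_distrib[of "\<lambda>x. x * _"] sum.delta)
qed

definition deviation_gain :: "('i, 's) game \<Rightarrow> 'i \<Rightarrow> ('s \<Rightarrow> 's pmf) \<Rightarrow> ('i \<Rightarrow> 's) \<Rightarrow> real" where
  "deviation_gain G i \<alpha> c =
     mixed_util G i ((\<lambda>j. return_pmf (c j))(i := \<alpha> (c i))) - util G i c"

lemma dual_vector_iff_gains:
  "dual_vector G \<alpha> \<longleftrightarrow> deviation_profile G \<alpha> \<and>
     (\<forall>c\<in>profiles G. 0 \<le> (\<Sum>i\<in>players G. deviation_gain G i (\<alpha> i) c))"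
  by (simp add: dual_vector_def deviation_gain_def)

text \<open>
  Utility is affine in player \<open>i\<close>'s own mixed strategy, and keeping the recommended strategy
  gains nothing.
\<close>

lemma lazy_deviation_gain:
  assumes "finite_game G" "i \<in> players G" "c \<in> profiles G" and e: "0 \<le> e" "e \<le> 1"
  shows "deviation_gain G i (lazy_plan e \<alpha>) c = e * deviation_gain G i \<alpha> c"
proof -
  let ?U = "\<lambda>\<mu>. mixed_util G i ((\<lambda>j. return_pmf (c j))(i := \<mu>))"
  have "?U (lazy_plan e \<alpha> (c i)) = e * ?U (\<alpha> (c i)) + (1 - e) * ?U (return_pmf (c i))"
    unfolding mixed_util_unilateral[OF assms(1-3)] lazy_plan_def pmf_bernoulli_mixture[OF e]
    by (simp add: algebra_simps sum.distrib sum_distrib_left sum_subtractf)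
  then show ?thesis
    unfolding deviation_gain_def mixed_util_pure[OF assms(1-3)] by (simp add: algebra_simps)
qed

text \<open>
  The summand \<open>f(c\<^sub>-\<^sub>i)\<close> is the same before and after a deviation of player \<open>i\<close>.  It
  enters the mixed utility with total weight one because the plan stays within player \<open>i\<close>'s
  strategies.
\<close>

lemma rescaled_deviation_gain:
  assumes fin: "finite_game G" "finite_game G'"
    and same: "profiles G' = profiles G" "players G' = players G" "strats G' i = strats G i"
    and i: "i \<in> players G" and c: "c \<in> profiles G"
    and plan: "deviation_plan (strats G i) \<alpha>"
    and util: "\<And>d. d \<in> profiles G \<Longrightarrow>
      util G' i d = a * util G i d + f (restrict d (players G - {i}))"
  shows "deviation_gain G' i \<alpha> c = a * deviation_gain G i \<alpha> c"
proof -
  let ?S = "strats G i" and ?\<mu> = "\<alpha> (c i)" and ?k = "f (restrict c (players G - {i}))"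
  have "c i \<in> ?S" using c i by (auto simp: profiles_def)
  then have total: "(\<Sum>s\<in>?S. pmf ?\<mu> s) = 1"
    using plan fin(1) i by (intro sum_pmf_eq_1) (auto simp: deviation_plan_def finite_game_def)
  have opponents: "restrict (c(i := s)) (players G - {i}) = restrict c (players G - {i})" for s
    by (auto simp: fun_eq_iff)
  have "mixed_util G' i ((\<lambda>j. return_pmf (c j))(i := ?\<mu>))
      = (\<Sum>s\<in>?S. pmf ?\<mu> s * util G' i (c(i := s)))"
    using mixed_util_unilateral[OF fin(2), of i c ?\<mu>] i c same by simp
  also have "\<dots> = (\<Sum>s\<in>?S. a * (pmf ?\<mu> s * util G i (c(i := s))) + pmf ?\<mu> s * ?k)"
    by (intro sum.cong refl) (simp add: util profile_update[OF c i] opponents algebra_simps)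
  also have "\<dots> = a * (\<Sum>s\<in>?S. pmf ?\<mu> s * util G i (c(i := s))) + (\<Sum>s\<in>?S. pmf ?\<mu> s) * ?k"
    by (simp only: sum.distrib sum_distrib_left sum_distrib_right)
  also have "\<dots> = a * mixed_util G i ((\<lambda>j. return_pmf (c j))(i := ?\<mu>)) + ?k"
    unfolding total mixed_util_unilateral[OF fin(1) i c] by simp
  finally show ?thesis
    unfolding deviation_gain_def by (simp add: util[OF c] algebra_simps)
qed

section \<open>Dual reductions of rescaled games\<close>

theorem proposition10:
  fixes \<Gamma> \<Gamma>' :: "('i, 's) game"
    and \<alpha> :: "'i \<Rightarrow> 's \<Rightarrow> 's pmf"
  assumes "finite_game \<Gamma>"
    and "is_rescaling \<Gamma> \<Gamma>'"
    and "dual_vector \<Gamma> \<alpha>"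
  shows "(\<exists>\<alpha>'. dual_vector \<Gamma>' \<alpha>' \<and> reduced_game \<Gamma>' \<alpha>' = reduced_game \<Gamma>' \<alpha>) \<and>
         dual_reduction \<Gamma>' (reduced_game \<Gamma>' \<alpha>)"
proof -
  let ?N = "players \<Gamma>"
  have N: "finite ?N" "?N \<noteq> {}"
    using assms(1) by (auto simp: finite_game_def)
  have same: "players \<Gamma>' = ?N" "\<And>i. i \<in> ?N \<Longrightarrow> strats \<Gamma>' i = strats \<Gamma> i"
    using assms(2) by (auto simp: is_rescaling_def)
  have profiles: "profiles \<Gamma>' = profiles \<Gamma>"
    unfolding profiles_def same(1) by (intro PiE_cong) (rule same(2))
  have fin': "finite_game \<Gamma>'"
    using assms(1) same by (simp add: finite_game_def)
  have plans: "deviation_plan (strats \<Gamma> i) (\<alpha> i)" if "i \<in> ?N" for i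
    using assms(3) that by (simp add: dual_vector_iff_gains deviation_profile_def)
  have "\<forall>i\<in>?N. \<exists>a. a > 0 \<and> (\<exists>f :: ('i \<Rightarrow> 's) \<Rightarrow> real. \<forall>c\<in>profiles \<Gamma>.
      util \<Gamma>' i c = a * util \<Gamma> i c + f (restrict c (?N - {i})))"
    using assms(2) by (auto simp: is_rescaling_def)
  from bchoice[OF this] obtain a where a: "\<And>i. i \<in> ?N \<Longrightarrow> a i > (0::real)"
    and util: "\<And>i. i \<in> ?N \<Longrightarrow> \<exists>f :: ('i \<Rightarrow> 's) \<Rightarrow> real. \<forall>c\<in>profiles \<Gamma>.
      util \<Gamma>' i c = a i * util \<Gamma> i c + f (restrict c (?N - {i}))"
    by blast
  define m where "m = Min (a ` ?N)"
  define e where "e i = m / a i" for i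
  define \<alpha>' where "\<alpha>' i = lazy_plan (e i) (\<alpha> i)" for i
  have m: "0 < m" "\<And>i. i \<in> ?N \<Longrightarrow> m \<le> a i"
    using N a by (auto simp: m_def)
  have e: "0 < e i" "e i \<le> 1" "e i * a i = m" if "i \<in> ?N" for i
    using m a[OF that] that by (auto simp: e_def)
  have gain: "deviation_gain \<Gamma>' i (\<alpha>' i) c = m * deviation_gain \<Gamma> i (\<alpha> i) c"
    if i: "i \<in> ?N" and c: "c \<in> profiles \<Gamma>" for i c
  proof -
    obtain f :: "('i \<Rightarrow> 's) \<Rightarrow> real" where f: "\<And>d. d \<in> profiles \<Gamma> \<Longrightarrow>
        util \<Gamma>' i d = a i * util \<Gamma> i d + f (restrict d (?N - {i}))"
      using util[OF i] by blast
    have "deviation_gain \<Gamma>' i (\<alpha>' i) c = e i * deviation_gain \<Gamma>' i (\<alpha> i) c"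
      unfolding \<alpha>'_def
      by (rule lazy_deviation_gain) (use fin' i c same profiles e[OF i] in auto)
    also have "deviation_gain \<Gamma>' i (\<alpha> i) c = a i * deviation_gain \<Gamma> i (\<alpha> i) c"
      by (rule rescaled_deviation_gain[where f = f])
         (use assms(1) fin' profiles same i c plans[OF i] f in auto)
    finally show ?thesis
      using e(3)[OF i] by simp
  qed
  have "dual_vector \<Gamma>' \<alpha>'"
    unfolding dual_vector_iff_gains
  proof (intro conjI ballI)
    show "deviation_profile \<Gamma>' \<alpha>'"
      using e plans by (simp add: deviation_profile_def \<alpha>'_def same deviation_plan_lazy_plan)
  next
    fix c assume "c \<in> profiles \<Gamma>'"
    then have c: "c \<in> profiles \<Gamma>" by (simp add: profiles)
    have "(\<Sum>i\<in>?N. deviation_gain \<Gamma>' i (\<alpha>' i) c) = m * (\<Sum>i\<in>?N. deviation_gain \<Gamma> i (\<alpha> i) c)"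
      by (simp add: gain[OF _ c] sum_distrib_left)
    moreover have "0 \<le> (\<Sum>i\<in>?N. deviation_gain \<Gamma> i (\<alpha> i) c)"
      using assms(3) c by (simp add: dual_vector_iff_gains)
    ultimately show "0 \<le> (\<Sum>i\<in>players \<Gamma>'. deviation_gain \<Gamma>' i (\<alpha>' i) c)"
      using m(1) by (simp add: same)
  qed
  moreover have "reduced_game \<Gamma>' \<alpha>' = reduced_game \<Gamma>' \<alpha>"
    using e by (intro reduced_game_cong) (simp add: \<alpha>'_def same quotient_strats_lazy_plan)
  ultimately show ?thesis
    unfolding dual_reduction_def by fastforce
qed

end
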